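(* Let $(\Omega,\mathcal A,P)$ be a probability space and let $m,n\ge 1$ be integers. For each $i\in\{1,\dots,m\}$ and $P$-almost every $\omega\in\Omega$ let $X_i(\omega)\subset\mathbb R^n$ be a closed convex set, and set $X(\omega)=X_1(\omega)\times\cdots\times X_m(\omega)$. For each $i\in\{1,\dots,m\}$ let $w_i:\Omega\times\mathbb R^{mn}\to\mathbb R$ be such that $w_i(\omega,\cdot)\in C^1(\mathbb R^{mn})$ and $w_i(\omega,q)=w_i(\omega,q_i,q_{-i})$ is concave with respect to $q_i\in\mathbb R^n$. Define $F:\Omega\times\mathbb R^{mn}\to\mathbb R^{mn}$ by $$F(\omega,q)=\bigl(-\nabla_{q_1}w_1(\omega,q),\dots,-\nabla_{q_m}w_m(\omega,q)\bigr).$$ Let $q^*(\omega)=(q_1^*(\omega),\dots,q_m^*(\omega))\in X(\omega)$ be a random vector. Then $q^*(\omega)$ is a stochastic Nash equilibrium if and only if, $P$-a.s., $$F(\omega,q^*(\omega))\cdot(q-q^*(\omega))=\sum_{r=1}^m -\nabla_{q_r}w_r(\omega,q^*(\omega))\cdot(q_r-q_r^*(\omega))\ge 0\qquad\text{for all } q\in X(\omega).$$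
   Context: There are $m$ players; player $i$ has strategy vector $q_i=(q_{i1},\dots,q_{in})\in X_i(\omega)\subset\mathbb R^n$ and utility (welfare) function $w_i$. Notation: $q=(q_1,\dots,q_m)\in\mathbb R^{mn}$, $q_{-i}=(q_1,\dots,q_{i-1},q_{i+1},\dots,q_m)$, and one writes $q=(q_i,q_{-i})$. $\nabla_{q_i}$ denotes the partial gradient with respect to the block $q_i$. Stochastic Nash equilibrium: a random vector $q^*(\omega)=(q_1^*(\omega),\dots,q_m^*(\omega))\in X(\omega)$ such that, $P$-a.s., $$w_i(\omega,q_i^*(\omega),q_{-i}^*(\omega))\ge w_i(\omega,q_i,q_{-i}^*(\omega))\qquad\forall q_i\in X_i(\omega),\ \forall i\in\{1,\dots,m\}.$$ *)

theory Defs
  imports "HOL-Probability.Probability"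
begin

text \<open>
  Players are indexed by the finite type \<open>'m\<close> and the coordinates of a strategy vector by the
  finite type \<open>'n\<close>. A strategy profile is an element of \<open>real ^ 'n ^ 'm\<close>, whose inner product is
  that of \<open>\<real>\<^sup>m\<^sup>n\<close>.
\<close>

text \<open>The profile \<open>(x, q\<^sub>-\<^sub>i)\<close>: block \<open>i\<close> of \<open>q\<close> is replaced by \<open>x\<close>.\<close>

definition with_block :: "'m::finite \<Rightarrow> real ^ 'n \<Rightarrow> real ^ 'n ^ 'm \<Rightarrow> real ^ 'n ^ 'm" where
  "with_block i x q = (\<chi> j. if j = i then x else q $ j)"

definition continuously_differentiable :: "('a::real_inner \<Rightarrow> real) \<Rightarrow> bool" where
  "continuously_differentiable f \<longleftrightarrow>
     (\<exists>g. (\<forall>x. GDERIV f x :> g x) \<and> continuous_on UNIV g)"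

definition gradient :: "('a::real_inner \<Rightarrow> real) \<Rightarrow> 'a \<Rightarrow> 'a" where
  "gradient f x = (THE D. GDERIV f x :> D)"

definition partial_gradient ::
    "'m::finite \<Rightarrow> (real ^ 'n ^ 'm \<Rightarrow> real) \<Rightarrow> real ^ 'n ^ 'm \<Rightarrow> real ^ 'n" where
  "partial_gradient i f q = gradient (\<lambda>x. f (with_block i x q)) (q $ i)"

definition profiles :: "('m::finite \<Rightarrow> '\<omega> \<Rightarrow> (real ^ 'n) set) \<Rightarrow> '\<omega> \<Rightarrow> (real ^ 'n ^ 'm) set" where
  "profiles X \<omega> = {q. \<forall>i. q $ i \<in> X i \<omega>}"

definition game_map ::
    "('m::finite \<Rightarrow> '\<omega> \<Rightarrow> real ^ 'n ^ 'm \<Rightarrow> real) \<Rightarrow> '\<omega> \<Rightarrow> real ^ 'n ^ 'm \<Rightarrow> real ^ 'n ^ 'm" where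
  "game_map w \<omega> q = (\<chi> r. - partial_gradient r (w r \<omega>) q)"

text \<open>
  The sets \<open>X i \<omega>\<close> are meaningful only for almost every \<open>\<omega>\<close>, so feasibility of the profile is
  required almost surely.
\<close>

definition stochastic_nash_equilibrium ::
    "'\<omega> measure \<Rightarrow> ('m::finite \<Rightarrow> '\<omega> \<Rightarrow> (real ^ 'n) set)
      \<Rightarrow> ('m \<Rightarrow> '\<omega> \<Rightarrow> real ^ 'n ^ 'm \<Rightarrow> real) \<Rightarrow> ('\<omega> \<Rightarrow> real ^ 'n ^ 'm) \<Rightarrow> bool" where
  "stochastic_nash_equilibrium M X w qs \<longleftrightarrow>
     qs \<in> borel_measurable M \<and>
     (AE \<omega> in M. qs \<omega> \<in> profiles X \<omega>) \<and>
     (AE \<omega> in M. \<forall>i. \<forall>x \<in> X i \<omega>.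
        w i \<omega> (with_block i (qs \<omega> $ i) (qs \<omega>)) \<ge> w i \<omega> (with_block i x (qs \<omega>)))"

end

theory Submission
  imports Defs
begin

text \<open>
  Fix an outcome. A differentiable concave function lies below its tangent planes and has
  nonpositive one-sided slopes at a maximizer over a convex set, so player \<open>i\<close> has no profitable
  deviation if and only if the variational inequality of that player alone holds. The inequality on
  the product of the strategy sets splits into these, since a deviation may be confined to a single
  block.
\<close>

text \<open>Uniqueness of the derivative lets the description operator in \<open>gradient\<close> be
  evaluated at any vector known to represent the derivative.\<close>

lemma gradient_eqI:
  assumes "GDERIV f x :> D"
  shows "gradient f x = D"
  unfolding gradient_def
proof (rule the_equality)
  show "GDERIV f x :> D" by fact
next
  fix E assume "GDERIV f x :> E"
  then have "(\<lambda>h. h \<bullet> E) = (\<lambda>h. h \<bullet> D)"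
    using assms has_derivative_unique unfolding gderiv_def by blast
  then have "\<forall>h. h \<bullet> E = h \<bullet> D" by meson
  then show "E = D" by (simp only: vector_eq_ldot)
qed

lemma with_block_same [simp]: "with_block i (q $ i) q = q"
  by (simp add: with_block_def vec_eq_iff)

text \<open>A unilateral deviation is an affine function of \<open>x\<close>, moving the profile
  along block \<open>i\<close> only. Both the chain rule and the block splitting of inner products
  rest on this form.\<close>

lemma with_block_eq_axis: "with_block i x q = q + axis i (x - q $ i)"
  by (simp add: with_block_def vec_eq_iff axis_def)

text \<open>Chain rule along the affine map \<open>x \<mapsto> with_block i x q\<close>: its linear
  part is \<open>axis i\<close>, whose adjoint is the projection onto block \<open>i\<close>, so
  only \<open>G $ i\<close> survives.\<close>

lemma GDERIV_with_block:
  fixes f :: "real ^ 'n::finite ^ 'm::finite \<Rightarrow> real"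
  assumes "GDERIV f (with_block i x q) :> G"
  shows "GDERIV (\<lambda>x. f (with_block i x q)) x :> G $ i"
proof -
  have "linear (axis i :: real ^ 'n \<Rightarrow> real ^ 'n ^ 'm)"
    by (rule linearI) (simp_all add: axis_def vec_eq_iff)
  then have axis: "bounded_linear (axis i :: real ^ 'n \<Rightarrow> real ^ 'n ^ 'm)"
    by (simp add: linear_conv_bounded_linear)
  have "((\<lambda>x. x - q $ i) has_derivative (\<lambda>h. h)) (at x)"
    by (auto intro!: derivative_eq_intros)
  from has_derivative_add[OF has_derivative_const bounded_linear.has_derivative[OF axis this], of q]
  have "((\<lambda>x. with_block i x q) has_derivative (\<lambda>h. axis i h)) (at x)"
    by (simp add: with_block_eq_axis)
  from has_derivative_compose[OF this] assms
  have "((\<lambda>x. f (with_block i x q)) has_derivative (\<lambda>h. axis i h \<bullet> G)) (at x)"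
    unfolding gderiv_def by blast
  then show ?thesis
    by (simp add: gderiv_def inner_axis')
qed

lemma GDERIV_partial_gradient:
  fixes f :: "real ^ 'n::finite ^ 'm::finite \<Rightarrow> real"
  assumes "continuously_differentiable f"
  shows "GDERIV (\<lambda>x. f (with_block i x q)) (q $ i) :> partial_gradient i f q"
proof -
  from assms obtain g where "\<And>x. GDERIV f x :> g x"
    unfolding continuously_differentiable_def by blast
  then have "GDERIV (\<lambda>x. f (with_block i x q)) (q $ i) :> g (with_block i (q $ i) q) $ i"
    by (intro GDERIV_with_block)
  then show ?thesis
    using gradient_eqI unfolding partial_gradient_def by metis
qed

text \<open>The limit is taken from the right because, in a convex set, moving from \<open>a\<close>
  towards another point stays inside only for small positive \<open>t\<close>.\<close>

lemma GDERIV_imp_directional_limit: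
  assumes "GDERIV f a :> D"
  shows "((\<lambda>t. (f (a + t *\<^sub>R v) - f a) / t) \<longlongrightarrow> v \<bullet> D) (at_right 0)"
proof -
  have "((\<lambda>t. a + t *\<^sub>R v) has_derivative (\<lambda>t. t *\<^sub>R v)) (at (0::real))"
    by (auto intro!: derivative_eq_intros)
  moreover have "(f has_derivative (\<lambda>h. h \<bullet> D)) (at (a + 0 *\<^sub>R v))"
    using assms by (simp add: gderiv_def)
  ultimately have "((\<lambda>t. f (a + t *\<^sub>R v)) has_derivative (\<lambda>t. t *\<^sub>R v \<bullet> D)) (at 0)"
    by (rule has_derivative_compose)
  then have "((\<lambda>t. f (a + t *\<^sub>R v)) has_real_derivative v \<bullet> D) (at 0)"
    by (rule has_derivative_imp_has_field_derivative) (simp add: mult.commute)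
  then have "((\<lambda>t. (f (a + t *\<^sub>R v) - f a) / t) \<longlongrightarrow> v \<bullet> D) (at 0)"
    by (simp add: DERIV_def)
  then show ?thesis
    by (rule filterlim_mono) (simp_all add: at_le)
qed

text \<open>By concavity the slope of the chord over \<open>[0, t]\<close> is at least that of the
  full chord, which is \<open>f x - f a\<close>; letting \<open>t\<close> tend to 0 turns the former
  into the directional derivative.\<close>

lemma concave_on_le_tangent:
  assumes "concave_on S f" "GDERIV f a :> D" "a \<in> S" "x \<in> S"
  shows "f x \<le> f a + (x - a) \<bullet> D"
proof -
  have "eventually (\<lambda>t. t \<in> {0<..<1}) (at_right (0::real))"
    by (rule eventually_at_right_real) simp
  then have "eventually (\<lambda>t. f x - f a \<le> (f (a + t *\<^sub>R (x - a)) - f a) / t) (at_right 0)"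
  proof eventually_elim
    case (elim t)
    have "(1 - t) * f a + t * f x \<le> f ((1 - t) *\<^sub>R a + t *\<^sub>R x)"
      using assms elim by (intro concave_onD) auto
    also have "(1 - t) *\<^sub>R a + t *\<^sub>R x = a + t *\<^sub>R (x - a)"
      by (simp add: algebra_simps)
    finally show ?case
      using elim by (simp add: field_simps)
  qed
  then have "f x - f a \<le> (x - a) \<bullet> D"
    using GDERIV_imp_directional_limit[OF assms(2)]
    by (intro tendsto_lowerbound) auto
  then show ?thesis by simp
qed

text \<open>The segment from \<open>a\<close> to \<open>x\<close> lies in \<open>S\<close>, so every
  difference quotient along it is nonpositive, and so is the limit.\<close>

lemma maximizer_imp_variational_inequality:
  assumes "convex S" "GDERIV f a :> D" "a \<in> S" "x \<in> S" "\<And>y. y \<in> S \<Longrightarrow> f y \<le> f a"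
  shows "(x - a) \<bullet> D \<le> 0"
proof -
  have "eventually (\<lambda>t. t \<in> {0<..<1}) (at_right (0::real))"
    by (rule eventually_at_right_real) simp
  then have "eventually (\<lambda>t. (f (a + t *\<^sub>R (x - a)) - f a) / t \<le> 0) (at_right 0)"
  proof eventually_elim
    case (elim t)
    have "(1 - t) *\<^sub>R a + t *\<^sub>R x \<in> S"
      using assms elim by (intro convexD) auto
    also have "(1 - t) *\<^sub>R a + t *\<^sub>R x = a + t *\<^sub>R (x - a)"
      by (simp add: algebra_simps)
    finally show ?case
      using elim assms(5) by (simp add: divide_le_0_iff)
  qed
  then show ?thesis
    using GDERIV_imp_directional_limit[OF assms(2)]
    by (intro tendsto_upperbound) auto
qed

lemma concave_maximizer_iff_variational_inequality:
  assumes "concave_on S f" "GDERIV f a :> D" "a \<in> S"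
  shows "(\<forall>x\<in>S. f x \<le> f a) \<longleftrightarrow> (\<forall>x\<in>S. 0 \<le> - D \<bullet> (x - a))"
proof
  assume "\<forall>x\<in>S. f x \<le> f a"
  then show "\<forall>x\<in>S. 0 \<le> - D \<bullet> (x - a)"
    \<comment> \<open>Concavity on \<open>S\<close> includes convexity of \<open>S\<close>, which is
      all this direction takes from it.\<close>
    using maximizer_imp_variational_inequality[OF concave_on_imp_convex[OF assms(1)] assms(2,3)]
    by (auto simp: inner_commute)
next
  assume *: "\<forall>x\<in>S. 0 \<le> - D \<bullet> (x - a)"
  show "\<forall>x\<in>S. f x \<le> f a"
  proof
    fix x assume "x \<in> S"
    then show "f x \<le> f a"
      using concave_on_le_tangent[OF assms, of x] * by (auto simp: inner_commute)
  qed
qed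

lemma product_variational_inequality_iff:
  fixes a F :: "real ^ 'n::finite ^ 'm::finite"
  assumes "\<And>i. a $ i \<in> S i"
  shows "(\<forall>q. (\<forall>i. q $ i \<in> S i) \<longrightarrow> 0 \<le> F \<bullet> (q - a)) \<longleftrightarrow>
    (\<forall>i. \<forall>x\<in>S i. 0 \<le> F $ i \<bullet> (x - a $ i))"
proof (intro iffI allI ballI impI)
  fix i x assume *: "\<forall>q. (\<forall>i. q $ i \<in> S i) \<longrightarrow> 0 \<le> F \<bullet> (q - a)" and "x \<in> S i"
  \<comment> \<open>The test profile deviates from \<open>a\<close> in block \<open>i\<close> alone;
    it is feasible because \<open>a\<close> is.\<close>
  then have "0 \<le> F \<bullet> (with_block i x a - a)"
    using assms by (auto simp: with_block_def)
  then show "0 \<le> F $ i \<bullet> (x - a $ i)"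
    by (simp add: with_block_eq_axis inner_axis)
next
  fix q assume "\<forall>i. \<forall>x\<in>S i. 0 \<le> F $ i \<bullet> (x - a $ i)" "\<forall>i. q $ i \<in> S i"
  then show "0 \<le> F \<bullet> (q - a)"
    \<comment> \<open>Fixing the left factor as \<open>F\<close> expands only the outer inner
      product, leaving a sum of nonnegative block terms.\<close>
    by (auto simp: inner_vec_def[of F] intro!: sum_nonneg)
qed

lemma nash_iff_variational_inequality:
  fixes w :: "'m::finite \<Rightarrow> '\<omega> \<Rightarrow> real ^ 'n::finite ^ 'm \<Rightarrow> real"
  assumes smooth: "\<And>i. continuously_differentiable (w i \<omega>)"
    and concave: "\<And>i. concave_on (X i \<omega>) (\<lambda>x. w i \<omega> (with_block i x a))"
    and feasible: "a \<in> profiles X \<omega>"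
  shows "(\<forall>i. \<forall>x\<in>X i \<omega>. w i \<omega> (with_block i x a) \<le> w i \<omega> (with_block i (a $ i) a)) \<longleftrightarrow>
    (\<forall>q\<in>profiles X \<omega>. 0 \<le> game_map w \<omega> a \<bullet> (q - a))"
proof -
  have "(\<forall>x\<in>X i \<omega>. w i \<omega> (with_block i x a) \<le> w i \<omega> (with_block i (a $ i) a)) \<longleftrightarrow>
    (\<forall>x\<in>X i \<omega>. 0 \<le> game_map w \<omega> a $ i \<bullet> (x - a $ i))" for i
    using concave_maximizer_iff_variational_inequality[OF concave GDERIV_partial_gradient[OF smooth]]
      feasible by (simp add: game_map_def profiles_def)
  then show ?thesis
    using product_variational_inequality_iff[of a "\<lambda>i. X i \<omega>" "game_map w \<omega> a"] feasible
    by (simp add: profiles_def)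
qed

theorem theorem2p1:
  fixes M :: "'\<omega> measure"
    and X :: "'m::finite \<Rightarrow> '\<omega> \<Rightarrow> (real ^ 'n::finite) set"
    and w :: "'m \<Rightarrow> '\<omega> \<Rightarrow> real ^ 'n ^ 'm \<Rightarrow> real"
    and qs :: "'\<omega> \<Rightarrow> real ^ 'n ^ 'm"
  assumes "prob_space M"
    and "\<And>i. AE \<omega> in M. closed (X i \<omega>) \<and> convex (X i \<omega>)"
    and "\<And>i \<omega>. \<omega> \<in> space M \<Longrightarrow> continuously_differentiable (w i \<omega>)"
    and "\<And>i \<omega> q. \<omega> \<in> space M \<Longrightarrow> concave_on UNIV (\<lambda>x. w i \<omega> (with_block i x q))"
    and "qs \<in> borel_measurable M"
    and "AE \<omega> in M. qs \<omega> \<in> profiles X \<omega>"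
  shows "(stochastic_nash_equilibrium M X w qs \<longleftrightarrow>
            (AE \<omega> in M. \<forall>q \<in> profiles X \<omega>. game_map w \<omega> (qs \<omega>) \<bullet> (q - qs \<omega>) \<ge> 0)) \<and>
         (\<forall>\<omega> \<in> space M. \<forall>q. game_map w \<omega> (qs \<omega>) \<bullet> (q - qs \<omega>) =
            (\<Sum>r\<in>UNIV. - partial_gradient r (w r \<omega>) (qs \<omega>) \<bullet> (q $ r - qs \<omega> $ r)))"
proof (intro conjI ballI allI)
  \<comment> \<open>With finitely many players, the exceptional null sets merge into one.\<close>
  have "AE \<omega> in M. \<forall>i. convex (X i \<omega>)"
    using assms(2) by (simp add: AE_all_countable)
  with assms(6) AE_space
  have "AE \<omega> in M.
    (\<forall>i. \<forall>x\<in>X i \<omega>. w i \<omega> (with_block i (qs \<omega> $ i) (qs \<omega>)) \<ge> w i \<omega> (with_block i x (qs \<omega>))) \<longleftrightarrow>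
    (\<forall>q\<in>profiles X \<omega>. game_map w \<omega> (qs \<omega>) \<bullet> (q - qs \<omega>) \<ge> 0)"
  proof eventually_elim
    case (elim \<omega>)
    then show ?case
      \<comment> \<open>Concavity on the whole space passes to \<open>X i \<omega>\<close> because
        that set is convex for the outcome at hand.\<close>
      using assms(3,4) by (intro nash_iff_variational_inequality)
        (auto simp: concave_on_def intro: convex_on_subset[OF _ subset_UNIV])
  qed
  \<comment> \<open>Conditions that are equivalent at almost every outcome hold almost surely
    together or not at all.\<close>
  from eventually_subst[OF this]
  show "stochastic_nash_equilibrium M X w qs \<longleftrightarrow>
      (AE \<omega> in M. \<forall>q\<in>profiles X \<omega>. game_map w \<omega> (qs \<omega>) \<bullet> (q - qs \<omega>) \<ge> 0)"
    using assms(5,6) by (simp add: stochastic_nash_equilibrium_def)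
next
  fix \<omega> q
  show "game_map w \<omega> (qs \<omega>) \<bullet> (q - qs \<omega>) =
      (\<Sum>r\<in>UNIV. - partial_gradient r (w r \<omega>) (qs \<omega>) \<bullet> (q $ r - qs \<omega> $ r))"
    unfolding inner_vec_def[of "game_map w \<omega> (qs \<omega>)"] by (simp add: game_map_def)
qed

end
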